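(* Let $R$ be a commutative ring with unity and let $S\subseteq R$ be a multiplicatively closed subset. Then $R$ is an $S$-field if and only if $R$ has no $S$-proper ideal.
   Context: A multiplicatively closed subset $S$ of a commutative ring $R$ is a subset with $1\in S$, $0\notin S$, and $st\in S$ for all $s,t\in S$. An ideal $I$ of $R$ with $I\cap S=\emptyset$ is $S$-maximal if there exists $s\in S$ such that for every ideal $J$ of $R$ with $I\subseteq J$, either $sJ\subseteq I$ or $J\cap S\neq\emptyset$. The ring $R$ is an $S$-field if its zero ideal $(0)$ is an $S$-maximal ideal of $R$. An ideal $I$ of $R$ is $S$-proper if $I\cap S=\emptyset$ and $sI\neq 0$ for all $s\in S$. *)

theory Defs
  imports "HOL-Algebra.Ideal"
begin

definition mult_closed_subset :: "('a, 'b) ring_scheme \<Rightarrow> 'a set \<Rightarrow> bool" where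
  "mult_closed_subset R S \<longleftrightarrow> submonoid S R \<and> \<zero>\<^bsub>R\<^esub> \<notin> S"

text \<open>For an element \<open>s\<close> and an ideal \<open>J\<close>, the set \<open>sJ = {sj | j \<in> J}\<close> is the left coset
  \<open>s <#\<^bsub>R\<^esub> J\<close> with respect to the multiplicative monoid of \<open>R\<close>.\<close>

definition S_maximal_ideal :: "('a, 'b) ring_scheme \<Rightarrow> 'a set \<Rightarrow> 'a set \<Rightarrow> bool" where
  "S_maximal_ideal R S I \<longleftrightarrow>
     ideal I R \<and> I \<inter> S = {} \<and>
     (\<exists>s\<in>S. \<forall>J. ideal J R \<longrightarrow> I \<subseteq> J \<longrightarrow> s <#\<^bsub>R\<^esub> J \<subseteq> I \<or> J \<inter> S \<noteq> {})"

definition S_field :: "('a, 'b) ring_scheme \<Rightarrow> 'a set \<Rightarrow> bool" where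
  "S_field R S \<longleftrightarrow> S_maximal_ideal R S {\<zero>\<^bsub>R\<^esub>}"

definition S_proper_ideal :: "('a, 'b) ring_scheme \<Rightarrow> 'a set \<Rightarrow> 'a set \<Rightarrow> bool" where
  "S_proper_ideal R S I \<longleftrightarrow>
     ideal I R \<and> I \<inter> S = {} \<and> (\<forall>s\<in>S. s <#\<^bsub>R\<^esub> I \<noteq> {\<zero>\<^bsub>R\<^esub>})"

end

theory Submission imports Defs begin

text \<open>If an \<open>S\<close>-field has an ideal \<open>I\<close> disjoint from \<open>S\<close>, then the element witnessing the
  \<open>S\<close>-maximality of \<open>(0)\<close> annihilates \<open>I\<close>, so \<open>I\<close> is not \<open>S\<close>-proper.

  For the converse, the difficulty is uniformity: the absence of \<open>S\<close>-proper ideals gives every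
  ideal disjoint from \<open>S\<close> an annihilator in \<open>S\<close>, but this annihilator depends on the ideal, whereas
  \<open>S\<close>-maximality of \<open>(0)\<close> asks for a single one.  The remedy is the \<open>S\<close>-torsion ideal
  \<open>N = {a. \<exists>s\<in>S. s a = 0}\<close>, the kernel of the localisation map from \<open>R\<close> to its ring of fractions
  with denominators in \<open>S\<close>.  Any ideal annihilated by some element of \<open>S\<close> lies in \<open>N\<close>
  (\<open>annihilated_subset_S_torsion\<close>), and \<open>N\<close> is itself disjoint from \<open>S\<close> (\<open>S_torsion_disjoint\<close>),
  because \<open>s a = 0\<close> with \<open>s, a \<in> S\<close> would put \<open>0\<close> into \<open>S\<close>.  Hence an annihilator of \<open>N\<close> serves
  all ideals disjoint from \<open>S\<close> at once.\<close>

definition S_torsion :: "('a, 'b) ring_scheme \<Rightarrow> 'a set \<Rightarrow> 'a set" where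
  "S_torsion R S = {a \<in> carrier R. \<exists>s\<in>S. s \<otimes>\<^bsub>R\<^esub> a = \<zero>\<^bsub>R\<^esub>}"

lemma (in cring) ideal_S_torsion:
  assumes "submonoid S R"
  shows "ideal (S_torsion R S) R"
proof -
  have S: "S \<subseteq> carrier R" "\<one> \<in> S" and mult: "\<And>s t. s \<in> S \<Longrightarrow> t \<in> S \<Longrightarrow> s \<otimes> t \<in> S"
    using assms by (auto simp: submonoid_def)
  have zero: "\<zero> \<in> S_torsion R S"
    using S by (auto simp: S_torsion_def intro!: bexI[of _ \<one>])
  have add: "a \<oplus> b \<in> S_torsion R S" if ab: "a \<in> S_torsion R S" "b \<in> S_torsion R S" for a b
  proof -
    from ab obtain s t where st: "s \<in> S" "t \<in> S" "s \<otimes> a = \<zero>" "t \<otimes> b = \<zero>"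
      and car: "a \<in> carrier R" "b \<in> carrier R" "s \<in> carrier R" "t \<in> carrier R"
      using S by (auto simp: S_torsion_def)
    have "(s \<otimes> t) \<otimes> (a \<oplus> b) = t \<otimes> (s \<otimes> a) \<oplus> s \<otimes> (t \<otimes> b)"
      using car by (simp add: r_distr m_ac)
    also have "\<dots> = \<zero>"
      using st car by simp
    finally show ?thesis
      using st car mult by (auto simp: S_torsion_def)
  qed
  have smult: "x \<otimes> a \<in> S_torsion R S" if a: "a \<in> S_torsion R S" and x: "x \<in> carrier R" for a x
  proof -
    from a obtain s where s: "s \<in> S" "s \<otimes> a = \<zero>" "a \<in> carrier R" "s \<in> carrier R"
      using S by (auto simp: S_torsion_def)
    have "s \<otimes> (x \<otimes> a) = x \<otimes> (s \<otimes> a)"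
      using s(3,4) x by (intro m_lcomm)
    also have "\<dots> = \<zero>"
      using s x by simp
    finally show ?thesis
      using s x by (auto simp: S_torsion_def)
  qed
  have neg: "\<ominus> a \<in> S_torsion R S" if "a \<in> S_torsion R S" for a
    using that S by (auto simp: S_torsion_def r_minus subset_iff)
  have carrier: "S_torsion R S \<subseteq> carrier R"
    by (auto simp: S_torsion_def)
  show ?thesis
  proof (rule idealI)
    show "subgroup (S_torsion R S) (add_monoid R)"
      using carrier zero add neg by (auto intro!: add.subgroupI)
  qed (use smult carrier m_comm ring_axioms in \<open>auto simp: subset_iff\<close>)
qed

lemma S_torsion_disjoint:
  assumes "mult_closed_subset R S"
  shows "S_torsion R S \<inter> S = {}"
  using assms by (fastforce simp: S_torsion_def mult_closed_subset_def submonoid_def)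

lemma annihilated_subset_S_torsion:
  assumes "s \<in> S" "J \<subseteq> carrier R" "s <#\<^bsub>R\<^esub> J \<subseteq> {\<zero>\<^bsub>R\<^esub>}"
  shows "J \<subseteq> S_torsion R S"
  using assms by (auto simp: S_torsion_def l_coset_def)

theorem proposition3p8:
  fixes R :: "('a, 'b) ring_scheme" and S :: "'a set"
  assumes "cring R"
    and "mult_closed_subset R S"
  shows "S_field R S \<longleftrightarrow> (\<nexists>I. S_proper_ideal R S I)"
proof -
  interpret cring R by (rule assms(1))
  have S: "submonoid S R" "\<zero>\<^bsub>R\<^esub> \<notin> S"
    using assms(2) by (auto simp: mult_closed_subset_def)
  show ?thesis
  proof
    assume "S_field R S"
    then obtain s where s: "s \<in> S"
      and ann: "\<And>J. ideal J R \<Longrightarrow> \<zero>\<^bsub>R\<^esub> \<in> J \<Longrightarrow> J \<inter> S = {} \<Longrightarrow> s <#\<^bsub>R\<^esub> J \<subseteq> {\<zero>\<^bsub>R\<^esub>}"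
      by (auto simp: S_field_def S_maximal_ideal_def)
    have "\<not> S_proper_ideal R S I" for I
    proof
      assume I: "S_proper_ideal R S I"
      then have "ideal I R" "I \<inter> S = {}"
        by (auto simp: S_proper_ideal_def)
      moreover from this have "\<zero>\<^bsub>R\<^esub> \<in> I"
        by (simp add: additive_subgroup.zero_closed ideal.axioms(1))
      ultimately have "s <#\<^bsub>R\<^esub> I \<subseteq> {\<zero>\<^bsub>R\<^esub>}" "s <#\<^bsub>R\<^esub> I \<noteq> {}"
        using ann by (auto simp: l_coset_def)
      then have "s <#\<^bsub>R\<^esub> I = {\<zero>\<^bsub>R\<^esub>}"
        by blast
      with I s show False
        by (auto simp: S_proper_ideal_def)
    qed
    then show "\<nexists>I. S_proper_ideal R S I"
      by blast
  next
    assume "\<nexists>I. S_proper_ideal R S I"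
    then have ann: "\<exists>s\<in>S. s <#\<^bsub>R\<^esub> J = {\<zero>\<^bsub>R\<^esub>}" if "ideal J R" "J \<inter> S = {}" for J
      using that by (auto simp: S_proper_ideal_def)
    obtain s where s: "s \<in> S" "s <#\<^bsub>R\<^esub> S_torsion R S = {\<zero>\<^bsub>R\<^esub>}"
      using ann ideal_S_torsion[OF S(1)] S_torsion_disjoint[OF assms(2)] by blast
    have "s <#\<^bsub>R\<^esub> J \<subseteq> {\<zero>\<^bsub>R\<^esub>}" if J: "ideal J R" "J \<inter> S = {}" for J
    proof -
      have "J \<subseteq> carrier R"
        using J(1) by (simp add: additive_subgroup.a_subset ideal.axioms(1))
      then have "J \<subseteq> S_torsion R S"
        using ann[OF J] annihilated_subset_S_torsion by (metis subset_refl)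
      then have "s <#\<^bsub>R\<^esub> J \<subseteq> s <#\<^bsub>R\<^esub> S_torsion R S"
        by (auto simp: l_coset_def)
      with s show ?thesis
        by simp
    qed
    then show "S_field R S"
      using s(1) S(2) zeroideal by (auto simp: S_field_def S_maximal_ideal_def)
  qed
qed

end
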